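(* Let $\vec{z}=(z_0,\dots,z_{l-1})$, $l\ge 1$, be a tuple of distinct variables all of the same (hidden-variable) sort. The sentence $\tilde\exists z_0\exists z_1\cdots\exists z_{l-1}\,{=}\!(\vec{z})$ is valid (satisfied by every team of every structure not having that sort). More generally, if $\varphi$ is a formula of independence logic in which the variables $\vec{z}$ do not occur (and the formula below is well formed), then $$\varphi\ \vdash\ \tilde\exists z_0\exists z_1\cdots\exists z_{l-1}\big(=\!(\vec{z})\wedge\varphi\big),$$ where $\vdash$ is derivability by the rules listed in the context.
   Context: Syntax. A vocabulary $\tau$ consists of a set $S_\tau\subseteq\mathbb{N}$ of sorts and sorted relation symbols; each variable $v$ has a sort $\mathrm{sort}(v)\in\mathbb{N}$. The $\tau$-formulas are: literals $u=v$, $\neg u=v$ ($u,v$ of the same sort), $R(\vec{x})$, $\neg R(\vec{x})$; independence atoms $\vec{y}\perp_{\vec{x}}\vec{z}$ for finite, possibly empty, tuples of variables of sorts in $S_\tau$; $\varphi\wedge\psi$, $\varphi\vee\psi$; $\exists v\varphi$, $\forall v\varphi$ with $\mathrm{sort}(v)\in S_\tau$; and $\tilde\exists v\varphi$, $\tilde\forall v\varphi$ where $\mathrm{sort}(v)\notin S_\tau$ and $\varphi$ is a formula of the vocabulary obtained from $\tau$ by adding the sort $\mathrm{sort}(v)$ (no new relation symbols) in which no variable of sort $\mathrm{sort}(v)$ other than $v$ occurs free. $=\!(\vec{x},\vec{y})$ abbreviates $\vec{y}\perp_{\vec{x}}\vec{y}$; $=\!(\vec{y})$ is the case of empty $\vec{x}$.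 Dependence logic is the fragment in which only independence atoms of the form $\vec{y}\perp_{\vec{x}}\vec{y}$ occur. Semantics. A $\tau$-structure $\mathfrak{A}$ has a nonempty domain $A_n$ for each $n\in S_\tau$. An expansion of $\mathfrak{A}$ by a sort $n\notin S_\tau$ additionally has a nonempty domain $A_n$ and otherwise equals $\mathfrak{A}$. A team $X$ of $\mathfrak{A}$ is a set of assignments with a common domain (a set of variables), each variable $v$ being mapped into $A_{\mathrm{sort}(v)}$. $X[A_{\mathrm{sort}(v)}/v]=\{s(a/v): s\in X,a\in A_{\mathrm{sort}(v)}\}$ and, for $F:X\to\mathcal{P}(A_{\mathrm{sort}(v)})\setminus\{\emptyset\}$, $X[F/v]=\{s(a/v): s\in X,a\in F(s)\}$, where $s(a/v)$ is $s$ modified or extended to map $v$ to $a$. Literals hold in $X$ if every $s\in X$ satisfies them; $\vec{y}\perp_{\vec{x}}\vec{z}$ holds if for all $s,s'\in X$ with $s(\vec{x})=s'(\vec{x})$ there is $s''\in X$ with $s''(\vec{x}\vec{y})=s(\vec{x}\vec{y})$ and $s''(\vec{z})=s'(\vec{z})$; $\wedge$ as usual; $\psi\vee\theta$ holds in $X$ if $X=Y\cup Z$ with $\psi$ holding in $Y$ and $\theta$ in $Z$; $\forall v\psi$ if $\psi$ holds in $X[A_{\mathrm{sort}(v)}/v]$; $\exists v\psi$ if $\psi$ holds in $X[F/v]$ for some $F$; $\mathfrak{A}\models_X\tilde\forall v\psi$ (resp. $\tilde\exists v\psi$) if $\mathfrak{B}\models_X\forall v\psi$ for all (resp. $\mathfrak{B}\models_X\exists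 v\psi$ for some) expansions $\mathfrak{B}$ of $\mathfrak{A}$ by the sort $\mathrm{sort}(v)$. Rules. $\Sigma\vdash\psi$ is the least relation (between sets of formulas and formulas of a common vocabulary), closed under the usual structural rules (assumption, weakening, cut), given by: (I) Independence atom: Constancy: $\vec{y}\perp_{\vec{x}}\vec{y}$ entails $\vec{y}\perp_{\vec{x}}\vec{z}$. Reflexivity: $\vec{x}\perp_{\vec{x}}\vec{y}$. Symmetry: $\vec{z}\perp_{\vec{x}}\vec{y}$ entails $\vec{y}\perp_{\vec{x}}\vec{z}$. Weakening: $\vec{y}y'\perp_{\vec{x}}\vec{z}z'$ entails $\vec{y}\perp_{\vec{x}}\vec{z}$. Permutation: each of the three tuples may be permuted. Fixed Parameter: $\vec{z}\perp_{\vec{x}}\vec{y}$ entails $\vec{y}\vec{x}\perp_{\vec{x}}\vec{z}\vec{x}$. First Transitivity: $\vec{x}\perp_{\vec{z}}\vec{y}\wedge\vec{u}\perp_{\vec{z}\vec{x}}\vec{y}$ entails $\vec{u}\perp_{\vec{z}}\vec{y}$. Second Transitivity: $\vec{y}\perp_{\vec{z}}\vec{y}\wedge\vec{z}\vec{x}\perp_{\vec{y}}\vec{u}$ entails $\vec{x}\perp_{\vec{z}}\vec{u}$. Exchange: $\vec{x}\perp_{\vec{z}}\vec{y}\wedge\vec{x}\vec{y}\perp_{\vec{z}}\vec{u}$ entails $\vec{x}\perp_{\vec{z}}\vec{y}\vec{u}$. (II) Dependence atom: $=\!(\vec{x}\vec{y},\vec{x})$; $=\!(\vec{x},\vec{y})\wedge=\!(\vec{y},\vec{z})$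 entails $=\!(\vec{x},\vec{z})$; $=\!(\vec{x},\vec{y})$ entails $=\!(\vec{x},\vec{x}\vec{y})$; both tuples may be permuted. (III) Semigraphoid axioms: $\vec{x}\perp_{\vec{z}}\emptyset$; Symmetry; $\vec{x}\perp_{\vec{z}}\vec{y}\vec{w}$ entails $\vec{x}\perp_{\vec{z}}\vec{y}$ (Decomposition) and entails $\vec{x}\perp_{\vec{z}\vec{w}}\vec{y}$ (Weak Union); $\vec{x}\perp_{\vec{z}}\vec{y}\wedge\vec{x}\perp_{\vec{z}\vec{y}}\vec{w}$ entails $\vec{x}\perp_{\vec{z}}\vec{y}\vec{w}$ (Contraction); Permutation; $\vec{x}\perp_{\vec{z}}\vec{y}$ entails $\vec{x}\vec{x}\perp_{\vec{z}\vec{z}}\vec{y}\vec{y}$ (Repetition). (IV) Logical rules: ($\exists$-elimination) if $\Sigma\cup\{\varphi\}\vdash\psi$ and $x$ is not free in $\psi$ or in any member of $\Sigma$, then $\Sigma\cup\{\exists x\varphi\}\vdash\psi$. ($\exists$-introduction) if $y$ has the same sort as $x$ and no free occurrence of $x$ in $\varphi$ lies in the scope of a quantifier $Qy$, then $\varphi(y/x)$ entails $\exists x\varphi$. ($\wedge$) $\varphi\wedge\psi$ entails $\varphi$ and $\psi$; $\{\varphi,\psi\}$ entails $\varphi\wedge\psi$. (Dependence introduction) $\exists x\varphi$ entails $\exists x(=\!(\vec{z},x)\wedge\varphi)$ whenever $\varphi$ is a formula of dependence logic and $\vec{z}$ lists the free variables of $\exists x\varphi$. (First $\tilde\exists$-introduction)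 if no variable of sort $\mathrm{sort}(x)$ occurs in any formula of $\Sigma$ and $\Sigma\vdash\exists x\varphi$, then $\Sigma\vdash\tilde\exists x\varphi$. (Second $\tilde\exists$-introduction) if no variable of sort $\mathrm{sort}(x)$ occurs in any formula of $\Sigma$ and $\Sigma\cup\{\exists x\varphi\}\vdash\exists y\psi$, where $\mathrm{sort}(y)=\mathrm{sort}(x)$, then $\Sigma\cup\{\tilde\exists x\varphi\}\vdash\tilde\exists y\psi$. *)

theory Defs
  imports "HOL-Library.Multiset"
begin

section \<open>Syntax\<close>

datatype var = Var (sort: nat) (index: nat)

record 'r vocab =
  sorts :: "nat set"
  rels :: "'r set"
  ar :: "'r \<Rightarrow> nat list"

definition is_vocab :: "'r vocab \<Rightarrow> bool" where
  "is_vocab \<tau> \<longleftrightarrow> (\<forall>R\<in>rels \<tau>. set (ar \<tau> R) \<subseteq> sorts \<tau>)"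

definition add_sort :: "nat \<Rightarrow> 'r vocab \<Rightarrow> 'r vocab" where
  "add_sort n \<tau> = \<tau>\<lparr>sorts := insert n (sorts \<tau>)\<rparr>"

text \<open>\<open>HExists\<close> and \<open>HForall\<close> are the quantifiers with a tilde, which quantify over a
  new sort together with a value of that sort.\<close>

datatype 'r form =
    Eq var var
  | Neq var var
  | Pos 'r "var list"
  | Neg 'r "var list"
  | Indep "var list" "var list" "var list"  (\<open>(_ \<bottom>\<^bsub>_\<^esub> _)\<close> [61, 0, 61] 60)
  | Conj "'r form" "'r form"
  | Disj "'r form" "'r form"
  | Exists var "'r form"
  | Forall var "'r form"
  | HExists var "'r form"
  | HForall var "'r form"

abbreviation Dep :: "var list \<Rightarrow> var list \<Rightarrow> 'r form" where
  "Dep xs ys \<equiv> ys \<bottom>\<^bsub>xs\<^esub> ys"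

abbreviation Const :: "var list \<Rightarrow> 'r form" where
  "Const ys \<equiv> Dep [] ys"

primrec fv :: "'r form \<Rightarrow> var set" where
  "fv (Eq u v) = {u, v}"
| "fv (Neq u v) = {u, v}"
| "fv (Pos R xs) = set xs"
| "fv (Neg R xs) = set xs"
| "fv (ys \<bottom>\<^bsub>xs\<^esub> zs) = set xs \<union> set ys \<union> set zs"
| "fv (Conj \<phi> \<psi>) = fv \<phi> \<union> fv \<psi>"
| "fv (Disj \<phi> \<psi>) = fv \<phi> \<union> fv \<psi>"
| "fv (Exists v \<phi>) = fv \<phi> - {v}"
| "fv (Forall v \<phi>) = fv \<phi> - {v}"
| "fv (HExists v \<phi>) = fv \<phi> - {v}"
| "fv (HForall v \<phi>) = fv \<phi> - {v}"

text \<open>All variables that occur: free, bound, or merely attached to a quantifier.\<close>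

primrec vars :: "'r form \<Rightarrow> var set" where
  "vars (Eq u v) = {u, v}"
| "vars (Neq u v) = {u, v}"
| "vars (Pos R xs) = set xs"
| "vars (Neg R xs) = set xs"
| "vars (ys \<bottom>\<^bsub>xs\<^esub> zs) = set xs \<union> set ys \<union> set zs"
| "vars (Conj \<phi> \<psi>) = vars \<phi> \<union> vars \<psi>"
| "vars (Disj \<phi> \<psi>) = vars \<phi> \<union> vars \<psi>"
| "vars (Exists v \<phi>) = insert v (vars \<phi>)"
| "vars (Forall v \<phi>) = insert v (vars \<phi>)"
| "vars (HExists v \<phi>) = insert v (vars \<phi>)"
| "vars (HForall v \<phi>) = insert v (vars \<phi>)"

text \<open>\<open>is_form \<phi> \<tau>\<close>: \<open>\<phi>\<close> is a \<open>\<tau>\<close>-formula of independence logic. The body of a tilde quantifier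
  is a formula of a larger vocabulary, so \<open>\<tau>\<close> varies in the recursion. A \<open>\<tau>\<close>-formula need not
  be a formula over an extension of \<open>\<tau>\<close> by a sort, as that sort may be bound in it by a
  tilde quantifier.\<close>

primrec is_form :: "'r form \<Rightarrow> 'r vocab \<Rightarrow> bool" where
  "is_form (Eq u v) \<tau> \<longleftrightarrow> sort u = sort v \<and> sort u \<in> sorts \<tau>"
| "is_form (Neq u v) \<tau> \<longleftrightarrow> sort u = sort v \<and> sort u \<in> sorts \<tau>"
| "is_form (Pos R xs) \<tau> \<longleftrightarrow> R \<in> rels \<tau> \<and> map sort xs = ar \<tau> R"
| "is_form (Neg R xs) \<tau> \<longleftrightarrow> R \<in> rels \<tau> \<and> map sort xs = ar \<tau> R"
| "is_form (ys \<bottom>\<^bsub>xs\<^esub> zs) \<tau> \<longleftrightarrow> sort ` (set xs \<union> set ys \<union> set zs) \<subseteq> sorts \<tau>"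
| "is_form (Conj \<phi> \<psi>) \<tau> \<longleftrightarrow> is_form \<phi> \<tau> \<and> is_form \<psi> \<tau>"
| "is_form (Disj \<phi> \<psi>) \<tau> \<longleftrightarrow> is_form \<phi> \<tau> \<and> is_form \<psi> \<tau>"
| "is_form (Exists v \<phi>) \<tau> \<longleftrightarrow> sort v \<in> sorts \<tau> \<and> is_form \<phi> \<tau>"
| "is_form (Forall v \<phi>) \<tau> \<longleftrightarrow> sort v \<in> sorts \<tau> \<and> is_form \<phi> \<tau>"
| "is_form (HExists v \<phi>) \<tau> \<longleftrightarrow> sort v \<notin> sorts \<tau> \<and> is_form \<phi> (add_sort (sort v) \<tau>) \<and>
     (\<forall>u\<in>fv \<phi>. sort u = sort v \<longrightarrow> u = v)"
| "is_form (HForall v \<phi>) \<tau> \<longleftrightarrow> sort v \<notin> sorts \<tau> \<and> is_form \<phi> (add_sort (sort v) \<tau>) \<and>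
     (\<forall>u\<in>fv \<phi>. sort u = sort v \<longrightarrow> u = v)"

primrec is_dep_form :: "'r form \<Rightarrow> bool" where
  "is_dep_form (Eq u v) \<longleftrightarrow> True"
| "is_dep_form (Neq u v) \<longleftrightarrow> True"
| "is_dep_form (Pos R xs) \<longleftrightarrow> True"
| "is_dep_form (Neg R xs) \<longleftrightarrow> True"
| "is_dep_form (ys \<bottom>\<^bsub>xs\<^esub> zs) \<longleftrightarrow> ys = zs"
| "is_dep_form (Conj \<phi> \<psi>) \<longleftrightarrow> is_dep_form \<phi> \<and> is_dep_form \<psi>"
| "is_dep_form (Disj \<phi> \<psi>) \<longleftrightarrow> is_dep_form \<phi> \<and> is_dep_form \<psi>"
| "is_dep_form (Exists v \<phi>) \<longleftrightarrow> is_dep_form \<phi>"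
| "is_dep_form (Forall v \<phi>) \<longleftrightarrow> is_dep_form \<phi>"
| "is_dep_form (HExists v \<phi>) \<longleftrightarrow> is_dep_form \<phi>"
| "is_dep_form (HForall v \<phi>) \<longleftrightarrow> is_dep_form \<phi>"

text \<open>\<open>subst y x \<phi>\<close> is \<open>\<phi>(y/x)\<close>: the free occurrences of \<open>x\<close> are replaced by \<open>y\<close>, without any
  renaming of bound variables.\<close>

definition ren :: "var \<Rightarrow> var \<Rightarrow> var \<Rightarrow> var" where
  "ren y x v = (if v = x then y else v)"

primrec subst :: "var \<Rightarrow> var \<Rightarrow> 'r form \<Rightarrow> 'r form" where
  "subst y x (Eq u v) = Eq (ren y x u) (ren y x v)"
| "subst y x (Neq u v) = Neq (ren y x u) (ren y x v)"
| "subst y x (Pos R us) = Pos R (map (ren y x) us)"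
| "subst y x (Neg R us) = Neg R (map (ren y x) us)"
| "subst y x (us \<bottom>\<^bsub>ws\<^esub> vs) = map (ren y x) us \<bottom>\<^bsub>map (ren y x) ws\<^esub> map (ren y x) vs"
| "subst y x (Conj \<phi> \<psi>) = Conj (subst y x \<phi>) (subst y x \<psi>)"
| "subst y x (Disj \<phi> \<psi>) = Disj (subst y x \<phi>) (subst y x \<psi>)"
| "subst y x (Exists v \<phi>) = Exists v (if v = x then \<phi> else subst y x \<phi>)"
| "subst y x (Forall v \<phi>) = Forall v (if v = x then \<phi> else subst y x \<phi>)"
| "subst y x (HExists v \<phi>) = HExists v (if v = x then \<phi> else subst y x \<phi>)"
| "subst y x (HForall v \<phi>) = HForall v (if v = x then \<phi> else subst y x \<phi>)"

text \<open>\<open>free_for y x \<phi>\<close>: no free occurrence of \<open>x\<close> in \<open>\<phi>\<close> lies in the scope of a quantifier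
  binding \<open>y\<close>.\<close>

primrec free_for :: "var \<Rightarrow> var \<Rightarrow> 'r form \<Rightarrow> bool" where
  "free_for y x (Eq u v) \<longleftrightarrow> True"
| "free_for y x (Neq u v) \<longleftrightarrow> True"
| "free_for y x (Pos R us) \<longleftrightarrow> True"
| "free_for y x (Neg R us) \<longleftrightarrow> True"
| "free_for y x (us \<bottom>\<^bsub>ws\<^esub> vs) \<longleftrightarrow> True"
| "free_for y x (Conj \<phi> \<psi>) \<longleftrightarrow> free_for y x \<phi> \<and> free_for y x \<psi>"
| "free_for y x (Disj \<phi> \<psi>) \<longleftrightarrow> free_for y x \<phi> \<and> free_for y x \<psi>"
| "free_for y x (Exists v \<phi>) \<longleftrightarrow> v = x \<or> (v = y \<longrightarrow> x \<notin> fv \<phi>) \<and> free_for y x \<phi>"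
| "free_for y x (Forall v \<phi>) \<longleftrightarrow> v = x \<or> (v = y \<longrightarrow> x \<notin> fv \<phi>) \<and> free_for y x \<phi>"
| "free_for y x (HExists v \<phi>) \<longleftrightarrow> v = x \<or> (v = y \<longrightarrow> x \<notin> fv \<phi>) \<and> free_for y x \<phi>"
| "free_for y x (HForall v \<phi>) \<longleftrightarrow> v = x \<or> (v = y \<longrightarrow> x \<notin> fv \<phi>) \<and> free_for y x \<phi>"


section \<open>Team semantics\<close>

text \<open>The domains of a structure are nonempty subsets of a universe type \<open>'a\<close>. The values of
  \<open>univ\<close> and \<open>interp\<close> outside of the vocabulary are irrelevant.\<close>

record ('r, 'a) struct =
  univ :: "nat \<Rightarrow> 'a set"
  interp :: "'r \<Rightarrow> 'a list set"

definition is_struct :: "'r vocab \<Rightarrow> ('r, 'a) struct \<Rightarrow> bool" where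
  "is_struct \<tau> A \<longleftrightarrow> (\<forall>n\<in>sorts \<tau>. univ A n \<noteq> {}) \<and>
     (\<forall>R\<in>rels \<tau>. \<forall>as\<in>interp A R. list_all2 (\<lambda>a n. a \<in> univ A n) as (ar \<tau> R))"

definition expand :: "('r, 'a) struct \<Rightarrow> nat \<Rightarrow> 'a set \<Rightarrow> ('r, 'a) struct" where
  "expand A n D = A\<lparr>univ := (univ A)(n := D)\<rparr>"

type_synonym 'a assignment = "var \<rightharpoonup> 'a"

definition is_team :: "'r vocab \<Rightarrow> ('r, 'a) struct \<Rightarrow> 'a assignment set \<Rightarrow> bool" where
  "is_team \<tau> A X \<longleftrightarrow> (\<exists>V. sort ` V \<subseteq> sorts \<tau> \<and>
     (\<forall>s\<in>X. dom s = V \<and> (\<forall>v\<in>V. the (s v) \<in> univ A (sort v))))"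

definition duplicate :: "'a assignment set \<Rightarrow> 'a set \<Rightarrow> var \<Rightarrow> 'a assignment set" where
  "duplicate X D v = {s(v \<mapsto> a) | s a. s \<in> X \<and> a \<in> D}"

definition supplement ::
  "'a assignment set \<Rightarrow> ('a assignment \<Rightarrow> 'a set) \<Rightarrow> var \<Rightarrow> 'a assignment set" where
  "supplement X F v = {s(v \<mapsto> a) | s a. s \<in> X \<and> a \<in> F s}"

text \<open>\<open>sat \<phi> A X\<close> is meant for a structure \<open>A\<close> and a team \<open>X\<close> over a vocabulary \<open>\<tau>\<close> and a
  \<open>\<tau>\<close>-formula \<open>\<phi>\<close> whose free variables are in the common domain of the members of \<open>X\<close>. The domain
  \<open>D\<close> of a new sort ranges over the nonempty subsets of the universe type, since HOL has no
  quantification over types.\<close>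

primrec sat :: "'r form \<Rightarrow> ('r, 'a) struct \<Rightarrow> 'a assignment set \<Rightarrow> bool" where
  "sat (Eq u v) A X \<longleftrightarrow> (\<forall>s\<in>X. the (s u) = the (s v))"
| "sat (Neq u v) A X \<longleftrightarrow> (\<forall>s\<in>X. the (s u) \<noteq> the (s v))"
| "sat (Pos R xs) A X \<longleftrightarrow> (\<forall>s\<in>X. map (\<lambda>v. the (s v)) xs \<in> interp A R)"
| "sat (Neg R xs) A X \<longleftrightarrow> (\<forall>s\<in>X. map (\<lambda>v. the (s v)) xs \<notin> interp A R)"
| "sat (ys \<bottom>\<^bsub>xs\<^esub> zs) A X \<longleftrightarrow> (\<forall>s\<in>X. \<forall>s'\<in>X. map s xs = map s' xs \<longrightarrow>
     (\<exists>s''\<in>X. map s'' (xs @ ys) = map s (xs @ ys) \<and> map s'' zs = map s' zs))"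
| "sat (Conj \<phi> \<psi>) A X \<longleftrightarrow> sat \<phi> A X \<and> sat \<psi> A X"
| "sat (Disj \<phi> \<psi>) A X \<longleftrightarrow> (\<exists>Y Z. X = Y \<union> Z \<and> sat \<phi> A Y \<and> sat \<psi> A Z)"
| "sat (Exists v \<phi>) A X \<longleftrightarrow>
     (\<exists>F. (\<forall>s\<in>X. F s \<noteq> {} \<and> F s \<subseteq> univ A (sort v)) \<and> sat \<phi> A (supplement X F v))"
| "sat (Forall v \<phi>) A X \<longleftrightarrow> sat \<phi> A (duplicate X (univ A (sort v)) v)"
| "sat (HExists v \<phi>) A X \<longleftrightarrow> (\<exists>D. D \<noteq> {} \<and>
     (\<exists>F. (\<forall>s\<in>X. F s \<noteq> {} \<and> F s \<subseteq> D) \<and> sat \<phi> (expand A (sort v) D) (supplement X F v)))"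
| "sat (HForall v \<phi>) A X \<longleftrightarrow> (\<forall>D. D \<noteq> {} \<longrightarrow>
     sat \<phi> (expand A (sort v) D) (duplicate X D v))"

lemma sat_HExists_iff:
  "sat (HExists v \<phi>) A X \<longleftrightarrow> (\<exists>D. D \<noteq> {} \<and> sat (Exists v \<phi>) (expand A (sort v) D) X)"
  by (simp add: expand_def)

lemma sat_HForall_iff:
  "sat (HForall v \<phi>) A X \<longleftrightarrow> (\<forall>D. D \<noteq> {} \<longrightarrow> sat (Forall v \<phi>) (expand A (sort v) D) X)"
  by (simp add: expand_def)


section \<open>Derivations\<close>

inductive indep_rule :: "'r form set \<Rightarrow> 'r form \<Rightarrow> bool" where
  constancy: "indep_rule {ys \<bottom>\<^bsub>xs\<^esub> ys} (ys \<bottom>\<^bsub>xs\<^esub> zs)"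
| reflexivity: "indep_rule {} (xs \<bottom>\<^bsub>xs\<^esub> ys)"
| symmetry: "indep_rule {zs \<bottom>\<^bsub>xs\<^esub> ys} (ys \<bottom>\<^bsub>xs\<^esub> zs)"
| weakening: "indep_rule {(ys @ [y']) \<bottom>\<^bsub>xs\<^esub> (zs @ [z'])} (ys \<bottom>\<^bsub>xs\<^esub> zs)"
| permutation: "\<lbrakk>mset xs' = mset xs; mset ys' = mset ys; mset zs' = mset zs\<rbrakk> \<Longrightarrow>
    indep_rule {ys \<bottom>\<^bsub>xs\<^esub> zs} (ys' \<bottom>\<^bsub>xs'\<^esub> zs')"
| fixed_parameter: "indep_rule {zs \<bottom>\<^bsub>xs\<^esub> ys} ((ys @ xs) \<bottom>\<^bsub>xs\<^esub> (zs @ xs))"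
| first_transitivity:
    "indep_rule {Conj (xs \<bottom>\<^bsub>zs\<^esub> ys) (us \<bottom>\<^bsub>zs @ xs\<^esub> ys)} (us \<bottom>\<^bsub>zs\<^esub> ys)"
| second_transitivity:
    "indep_rule {Conj (ys \<bottom>\<^bsub>zs\<^esub> ys) ((zs @ xs) \<bottom>\<^bsub>ys\<^esub> us)} (xs \<bottom>\<^bsub>zs\<^esub> us)"
| exchange:
    "indep_rule {Conj (xs \<bottom>\<^bsub>zs\<^esub> ys) ((xs @ ys) \<bottom>\<^bsub>zs\<^esub> us)} (xs \<bottom>\<^bsub>zs\<^esub> (ys @ us))"

inductive dep_rule :: "'r form set \<Rightarrow> 'r form \<Rightarrow> bool" where
  reflexivity: "dep_rule {} (Dep (xs @ ys) xs)"
| transitivity: "dep_rule {Conj (Dep xs ys) (Dep ys zs)} (Dep xs zs)"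
| augmentation: "dep_rule {Dep xs ys} (Dep xs (xs @ ys))"
| permutation: "\<lbrakk>mset xs' = mset xs; mset ys' = mset ys\<rbrakk> \<Longrightarrow> dep_rule {Dep xs ys} (Dep xs' ys')"

inductive semigraphoid_rule :: "'r form set \<Rightarrow> 'r form \<Rightarrow> bool" where
  triviality: "semigraphoid_rule {} (xs \<bottom>\<^bsub>zs\<^esub> [])"
| symmetry: "semigraphoid_rule {xs \<bottom>\<^bsub>zs\<^esub> ys} (ys \<bottom>\<^bsub>zs\<^esub> xs)"
| decomposition: "semigraphoid_rule {xs \<bottom>\<^bsub>zs\<^esub> (ys @ ws)} (xs \<bottom>\<^bsub>zs\<^esub> ys)"
| weak_union: "semigraphoid_rule {xs \<bottom>\<^bsub>zs\<^esub> (ys @ ws)} (xs \<bottom>\<^bsub>zs @ ws\<^esub> ys)"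
| contraction:
    "semigraphoid_rule {Conj (xs \<bottom>\<^bsub>zs\<^esub> ys) (xs \<bottom>\<^bsub>zs @ ys\<^esub> ws)} (xs \<bottom>\<^bsub>zs\<^esub> (ys @ ws))"
| permutation: "\<lbrakk>mset xs' = mset xs; mset ys' = mset ys; mset zs' = mset zs\<rbrakk> \<Longrightarrow>
    semigraphoid_rule {xs \<bottom>\<^bsub>zs\<^esub> ys} (xs' \<bottom>\<^bsub>zs'\<^esub> ys')"
| repetition: "semigraphoid_rule {xs \<bottom>\<^bsub>zs\<^esub> ys} ((xs @ xs) \<bottom>\<^bsub>zs @ zs\<^esub> (ys @ ys))"

inductive logical_rule :: "'r form set \<Rightarrow> 'r form \<Rightarrow> bool" where
  exists_intro: "\<lbrakk>sort y = sort x; free_for y x \<phi>\<rbrakk> \<Longrightarrow> logical_rule {subst y x \<phi>} (Exists x \<phi>)"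
| conj_elim1: "logical_rule {Conj \<phi> \<psi>} \<phi>"
| conj_elim2: "logical_rule {Conj \<phi> \<psi>} \<psi>"
| conj_intro: "logical_rule {\<phi>, \<psi>} (Conj \<phi> \<psi>)"
| dependence_intro: "\<lbrakk>is_dep_form \<phi>; distinct zs; set zs = fv (Exists x \<phi>)\<rbrakk> \<Longrightarrow>
    logical_rule {Exists x \<phi>} (Exists x (Conj (Dep zs [x]) \<phi>))"

text \<open>Derivability is indexed by the common vocabulary \<open>\<tau>\<close> of the premises and the conclusion.
  The premise of a tilde introduction rule is a derivation over the vocabulary that has the
  new sort.\<close>

inductive derives :: "'r form set \<Rightarrow> 'r vocab \<Rightarrow> 'r form \<Rightarrow> bool"
    (\<open>(_ \<turnstile>\<^bsub>_\<^esub> _)\<close> [51, 0, 51] 50) where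
  assumption: "\<lbrakk>\<forall>\<chi>\<in>\<Sigma>. is_form \<chi> \<tau>; \<psi> \<in> \<Sigma>\<rbrakk> \<Longrightarrow> \<Sigma> \<turnstile>\<^bsub>\<tau>\<^esub> \<psi>"
| weakening: "\<lbrakk>\<Sigma> \<turnstile>\<^bsub>\<tau>\<^esub> \<psi>; \<Sigma> \<subseteq> \<Sigma>'; \<forall>\<chi>\<in>\<Sigma>'. is_form \<chi> \<tau>\<rbrakk> \<Longrightarrow> \<Sigma>' \<turnstile>\<^bsub>\<tau>\<^esub> \<psi>"
| cut: "\<lbrakk>\<Sigma> \<turnstile>\<^bsub>\<tau>\<^esub> \<phi>; \<Sigma> \<union> {\<phi>} \<turnstile>\<^bsub>\<tau>\<^esub> \<psi>\<rbrakk> \<Longrightarrow> \<Sigma> \<turnstile>\<^bsub>\<tau>\<^esub> \<psi>"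
| rule: "\<lbrakk>indep_rule \<Sigma> \<psi> \<or> dep_rule \<Sigma> \<psi> \<or> semigraphoid_rule \<Sigma> \<psi> \<or> logical_rule \<Sigma> \<psi>;
    \<forall>\<chi>\<in>\<Sigma>. is_form \<chi> \<tau>; is_form \<psi> \<tau>\<rbrakk> \<Longrightarrow> \<Sigma> \<turnstile>\<^bsub>\<tau>\<^esub> \<psi>"
| exists_elim: "\<lbrakk>\<Sigma> \<union> {\<phi>} \<turnstile>\<^bsub>\<tau>\<^esub> \<psi>; x \<notin> fv \<psi>; \<forall>\<chi>\<in>\<Sigma>. x \<notin> fv \<chi>; is_form (Exists x \<phi>) \<tau>\<rbrakk> \<Longrightarrow>
    \<Sigma> \<union> {Exists x \<phi>} \<turnstile>\<^bsub>\<tau>\<^esub> \<psi>"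
| hexists_intro1: "\<lbrakk>\<Sigma> \<turnstile>\<^bsub>add_sort (sort x) \<tau>\<^esub> Exists x \<phi>;
    \<forall>\<chi>\<in>\<Sigma>. is_form \<chi> \<tau> \<and> sort x \<notin> sort ` vars \<chi>; is_form (HExists x \<phi>) \<tau>\<rbrakk> \<Longrightarrow>
    \<Sigma> \<turnstile>\<^bsub>\<tau>\<^esub> HExists x \<phi>"
| hexists_intro2: "\<lbrakk>\<Sigma> \<union> {Exists x \<phi>} \<turnstile>\<^bsub>add_sort (sort x) \<tau>\<^esub> Exists y \<psi>; sort y = sort x;
    \<forall>\<chi>\<in>\<Sigma>. is_form \<chi> \<tau> \<and> sort x \<notin> sort ` vars \<chi>;
    is_form (HExists x \<phi>) \<tau>; is_form (HExists y \<psi>) \<tau>\<rbrakk> \<Longrightarrow>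
    \<Sigma> \<union> {HExists x \<phi>} \<turnstile>\<^bsub>\<tau>\<^esub> HExists y \<psi>"

end

theory Submission
  imports Defs
begin

text \<open>Semantically, a singleton domain for the new sort makes all of its variables constant.
  Deductively, reflexivity and dependence introduction give \<open>\<exists>u =(u)\<close> for each single \<open>u\<close>, and the
  dependence rules merge constancy of two tuples into constancy of their concatenation. Since \<open>\<phi>\<close> is
  well formed both with and without the new sort, no variable of that sort occurs in \<open>\<phi>\<close>, as
  tilde introduction requires.\<close>

text \<open>Generalised for induction: \<open>ws\<close> collects the variables already quantified.
  Each quantifier is witnessed by the constant choice \<open>{a}\<close>, so at the end all
  assignments agree on the whole tuple and the atom is trivial.\<close>

lemma sat_foldr_Exists_Const:
  assumes "\<forall>s\<in>X. \<forall>v\<in>set ws. s v = Some a" and "\<forall>u\<in>set us. univ A (sort u) = {a}"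
  shows "sat (foldr Exists us (Const (ws @ us))) A X"
  using assms
proof (induction us arbitrary: ws X)
  case Nil
  have "map s ws = map s' ws" if "s \<in> X" "s' \<in> X" for s s'
    using that Nil.prems(1) by (intro map_cong refl) metis
  then show ?case by auto
next
  case (Cons u us)
  let ?Y = "supplement X (\<lambda>_. {a}) u"
  have "sat (foldr Exists us (Const ((ws @ [u]) @ us))) A ?Y"
    using Cons.prems by (intro Cons.IH) (auto simp: supplement_def)
  then show ?case using Cons.prems by auto
qed

lemma is_vocab_add_sort: "is_vocab \<tau> \<Longrightarrow> is_vocab (add_sort n \<tau>)"
  by (auto simp: is_vocab_def add_sort_def)

lemma sorts_add_sort [simp]: "sorts (add_sort n \<tau>) = insert n (sorts \<tau>)"
  by (simp add: add_sort_def)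

lemma add_sort_commute: "add_sort m (add_sort n \<tau>) = add_sort n (add_sort m \<tau>)"
  by (simp add: add_sort_def insert_commute)

text \<open>A variable of sort \<open>n\<close> that is free or bound by an ordinary quantifier
  would violate well-formedness over \<open>\<tau>\<close>; a tilde quantifier of sort
  \<open>n\<close> would violate it over \<open>add_sort n \<tau>\<close>, where \<open>n\<close> is
  no longer new.\<close>

lemma new_sort_notin_vars:
  assumes "is_form \<phi> \<tau>" "is_form \<phi> (add_sort n \<tau>)" "n \<notin> sorts \<tau>" "is_vocab \<tau>"
  shows "n \<notin> sort ` vars \<phi>"
proof -
  \<comment> \<open>For relational literals only the arity restricts the sorts, hence the appeal to
    \<open>is_vocab\<close>. The vocabulary is quantified afresh because it grows under tilde
    quantifiers.\<close>
  have rel: "n \<notin> sort ` set xs"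
    if "R \<in> rels \<tau>" "map sort xs = ar \<tau> R" "n \<notin> sorts \<tau>" "is_vocab \<tau>"
    for R xs and \<tau> :: "'a vocab"
    using that unfolding is_vocab_def by (metis list.set_map subsetD)
  show ?thesis
    using assms
  proof (induction \<phi> arbitrary: \<tau>)
    case (HExists v \<phi>)
    \<comment> \<open>Well-formedness over \<open>add_sort n \<tau>\<close> forces
      \<open>sort v \<noteq> n\<close>, so \<open>n\<close> is still new in the vocabulary of the
      body; commuting the two added sorts makes the induction hypothesis fit.\<close>
    then show ?case
      using HExists.IH[of "add_sort (sort v) \<tau>"]
      by (auto simp: add_sort_commute is_vocab_add_sort)
  next
    case (HForall v \<phi>)
    then show ?case
      using HForall.IH[of "add_sort (sort v) \<tau>"]
      by (auto simp: add_sort_commute is_vocab_add_sort)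
  next
    case (Pos R xs)
    then show ?case using rel[of R \<tau> xs] by (simp add: add_sort_def)
  next
    case (Neg R xs)
    then show ?case using rel[of R \<tau> xs] by (simp add: add_sort_def)
  qed (auto 0 3)
qed

lemma ren_self [simp]: "ren x x = (\<lambda>v. v)"
  by (auto simp: ren_def)

lemma subst_self [simp]: "subst x x \<phi> = \<phi>"
  by (induction \<phi>) auto

lemma free_for_self [simp]: "free_for x x \<phi>"
  by (induction \<phi>) auto

lemma is_form_foldr_Exists [simp]:
  "is_form (foldr Exists us \<phi>) \<tau> \<longleftrightarrow> sort ` set us \<subseteq> sorts \<tau> \<and> is_form \<phi> \<tau>"
  by (induction us) auto

lemma derives_trans:
  assumes "\<Sigma> \<turnstile>\<^bsub>\<tau>\<^esub> \<phi>" "{\<phi>} \<turnstile>\<^bsub>\<tau>\<^esub> \<psi>" "\<forall>\<chi>\<in>\<Sigma>. is_form \<chi> \<tau>" "is_form \<phi> \<tau>"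
  shows "\<Sigma> \<turnstile>\<^bsub>\<tau>\<^esub> \<psi>"
proof (rule derives.cut)
  show "\<Sigma> \<union> {\<phi>} \<turnstile>\<^bsub>\<tau>\<^esub> \<psi>"
    using assms by (intro derives.weakening[OF assms(2)]) auto
qed fact

lemma derives_Conj:
  assumes "\<Sigma> \<turnstile>\<^bsub>\<tau>\<^esub> \<phi>" "\<Sigma> \<turnstile>\<^bsub>\<tau>\<^esub> \<psi>"
    and "\<forall>\<chi>\<in>\<Sigma>. is_form \<chi> \<tau>" "is_form \<phi> \<tau>" "is_form \<psi> \<tau>"
  shows "\<Sigma> \<turnstile>\<^bsub>\<tau>\<^esub> Conj \<phi> \<psi>"
proof (rule derives.cut[OF assms(1)], rule derives.cut)
  show "\<Sigma> \<union> {\<phi>} \<turnstile>\<^bsub>\<tau>\<^esub> \<psi>"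
    using assms by (intro derives.weakening[OF assms(2)]) auto
  have "{\<phi>, \<psi>} \<turnstile>\<^bsub>\<tau>\<^esub> Conj \<phi> \<psi>"
    using assms by (intro derives.rule) (auto intro: logical_rule.conj_intro)
  then show "\<Sigma> \<union> {\<phi>} \<union> {\<psi>} \<turnstile>\<^bsub>\<tau>\<^esub> Conj \<phi> \<psi>"
    using assms by (elim derives.weakening) auto
qed

lemma derives_Dep_reflexivity:
  assumes "\<forall>\<chi>\<in>\<Sigma>. is_form \<chi> \<tau>" "sort ` (set xs \<union> set ys) \<subseteq> sorts \<tau>"
  shows "\<Sigma> \<turnstile>\<^bsub>\<tau>\<^esub> Dep (xs @ ys) xs"
proof -
  have "{} \<turnstile>\<^bsub>\<tau>\<^esub> Dep (xs @ ys) xs"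
    using assms(2) by (intro derives.rule) (auto intro: dep_rule.reflexivity)
  then show ?thesis
    using assms(1) by (elim derives.weakening) auto
qed

lemma derives_Dep_trans:
  assumes "\<Sigma> \<turnstile>\<^bsub>\<tau>\<^esub> Dep xs ys" "\<Sigma> \<turnstile>\<^bsub>\<tau>\<^esub> Dep ys zs"
    and "\<forall>\<chi>\<in>\<Sigma>. is_form \<chi> \<tau>" "sort ` (set xs \<union> set ys \<union> set zs) \<subseteq> sorts \<tau>"
  shows "\<Sigma> \<turnstile>\<^bsub>\<tau>\<^esub> Dep xs zs"
proof (rule derives_trans)
  show "\<Sigma> \<turnstile>\<^bsub>\<tau>\<^esub> Conj (Dep xs ys) (Dep ys zs)"
    using assms by (intro derives_Conj) auto
  show "{Conj (Dep xs ys) (Dep ys zs)} \<turnstile>\<^bsub>\<tau>\<^esub> Dep xs zs"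
    using assms(4) by (intro derives.rule) (auto intro: dep_rule.transitivity)
qed (use assms in auto)

text \<open>Constancy is dependence on the empty tuple, so transitivity through \<open>[]\<close>
  makes \<open>ys\<close> depend on \<open>xs\<close>. Augmentation then carries \<open>xs\<close>
  along, and constancy of \<open>xs\<close> passes on to \<open>xs @ ys\<close>.\<close>

lemma derives_Const_append:
  assumes "\<Sigma> \<turnstile>\<^bsub>\<tau>\<^esub> Const xs" "\<Sigma> \<turnstile>\<^bsub>\<tau>\<^esub> Const ys"
    and "\<forall>\<chi>\<in>\<Sigma>. is_form \<chi> \<tau>" "sort ` (set xs \<union> set ys) \<subseteq> sorts \<tau>"
  shows "\<Sigma> \<turnstile>\<^bsub>\<tau>\<^esub> Const (xs @ ys)"
proof -
  have "\<Sigma> \<turnstile>\<^bsub>\<tau>\<^esub> Dep xs []"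
    using derives_Dep_reflexivity[of \<Sigma> \<tau> "[]" xs] assms by (simp add: image_Un)
  then have "\<Sigma> \<turnstile>\<^bsub>\<tau>\<^esub> Dep xs ys"
    by (rule derives_Dep_trans) (use assms in auto)
  moreover have "{Dep xs ys} \<turnstile>\<^bsub>\<tau>\<^esub> Dep xs (xs @ ys)"
    using assms(4) by (intro derives.rule) (auto intro: dep_rule.augmentation)
  ultimately have "\<Sigma> \<turnstile>\<^bsub>\<tau>\<^esub> Dep xs (xs @ ys)"
    by (rule derives_trans) (use assms in auto)
  with assms(1) show ?thesis
    by (rule derives_Dep_trans) (use assms in auto)
qed

text \<open>Existential introduction with \<open>x\<close> as its own witness:
  \<open>subst x x\<close> is the identity and \<open>free_for x x\<close> always holds.\<close>

lemma derives_Exists: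
  assumes "\<Sigma> \<turnstile>\<^bsub>\<tau>\<^esub> \<phi>" "\<forall>\<chi>\<in>\<Sigma>. is_form \<chi> \<tau>" "is_form \<phi> \<tau>" "sort x \<in> sorts \<tau>"
  shows "\<Sigma> \<turnstile>\<^bsub>\<tau>\<^esub> Exists x \<phi>"
proof (rule derives_trans[OF assms(1)])
  have "logical_rule {\<phi>} (Exists x \<phi>)"
    using logical_rule.exists_intro[of x x \<phi>] by simp
  then show "{\<phi>} \<turnstile>\<^bsub>\<tau>\<^esub> Exists x \<phi>"
    using assms by (intro derives.rule) auto
qed (use assms in auto)

lemma derives_Exists_Const:
  assumes "\<forall>\<chi>\<in>\<Sigma>. is_form \<chi> \<tau>" "sort x \<in> sorts \<tau>"
  shows "\<Sigma> \<turnstile>\<^bsub>\<tau>\<^esub> Exists x (Const [x])"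
proof -
  \<comment> \<open>Dependence introduction needs some derivable \<open>\<exists>x \<theta>\<close>; the rules do not give \<open>x = x\<close>.\<close>
  define \<theta> :: "'a form" where "\<theta> = Dep [x] [x]"
  have form: "is_form \<theta> \<tau>"
    using assms by (simp add: \<theta>_def)
  have "{} \<turnstile>\<^bsub>\<tau>\<^esub> Exists x \<theta>"
    using derives_Exists[OF derives_Dep_reflexivity[of "{}" \<tau> "[x]" "[]"]] assms
    by (simp add: \<theta>_def)
  \<comment> \<open>\<open>x\<close> is the only free variable of \<open>\<theta>\<close>, so the
    quantified formula is closed: dependence introduction applies with the empty parameter tuple,
    and its atom is exactly \<open>Const [x]\<close>.\<close>
  moreover have "{Exists x \<theta>} \<turnstile>\<^bsub>\<tau>\<^esub> Exists x (Conj (Const [x]) \<theta>)"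
    using assms form
    by (intro derives.rule) (auto simp: \<theta>_def intro!: logical_rule.dependence_intro)
  ultimately have "{} \<turnstile>\<^bsub>\<tau>\<^esub> Exists x (Conj (Const [x]) \<theta>)"
    by (rule derives_trans) (use assms form in auto)
  \<comment> \<open>The auxiliary conjunct \<open>\<theta>\<close> is dropped under the quantifier:
    eliminate the quantifier, project, and reintroduce it.\<close>
  moreover have "{} \<union> {Exists x (Conj (Const [x]) \<theta>)} \<turnstile>\<^bsub>\<tau>\<^esub> Exists x (Const [x])"
  proof (rule derives.exists_elim)
    have "{Conj (Const [x]) \<theta>} \<turnstile>\<^bsub>\<tau>\<^esub> Const [x]"
      using assms form by (intro derives.rule) (auto intro: logical_rule.conj_elim1)
    then show "{} \<union> {Conj (Const [x]) \<theta>} \<turnstile>\<^bsub>\<tau>\<^esub> Exists x (Const [x])"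
      using assms form derives_Exists by fastforce
  qed (use assms form in auto)
  ultimately have "{} \<turnstile>\<^bsub>\<tau>\<^esub> Exists x (Const [x])"
    by (rule derives.cut)
  then show ?thesis
    using assms(1) by (elim derives.weakening) auto
qed

text \<open>Again \<open>ws\<close> accumulates the variables already treated. Keeping
  \<open>Const ws\<close> as a premise lets the induction move one variable at a time from
  \<open>us\<close> to \<open>ws\<close>.\<close>

lemma derives_foldr_Exists_Const:
  assumes "distinct us" "set us \<inter> set ws = {}" "set us \<inter> fv \<phi> = {}"
    and "is_form \<phi> \<tau>" "sort ` (set ws \<union> set us) \<subseteq> sorts \<tau>"
  shows "{Const ws, \<phi>} \<turnstile>\<^bsub>\<tau>\<^esub> foldr Exists us (Conj (Const (ws @ us)) \<phi>)"
  using assms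
proof (induction us arbitrary: ws)
  case Nil
  have "{Const ws, \<phi>} \<turnstile>\<^bsub>\<tau>\<^esub> Conj (Const ws) \<phi>"
    by (intro derives_Conj derives.assumption) (use Nil.prems in auto)
  then show ?case by simp
next
  case (Cons u us)
  let ?\<chi> = "foldr Exists us (Conj (Const (ws @ u # us)) \<phi>)"
  let ?\<Sigma> = "{Const ws, \<phi>}"
  have form: "\<forall>\<chi>\<in>?\<Sigma> \<union> {Const [u]}. is_form \<chi> \<tau>" "is_form ?\<chi> \<tau>" "sort u \<in> sorts \<tau>"
    using Cons.prems by auto
  have "{Const (ws @ [u]), \<phi>} \<turnstile>\<^bsub>\<tau>\<^esub> ?\<chi>"
    using Cons.IH[of "ws @ [u]"] Cons.prems by auto
  then have "?\<Sigma> \<union> {Const [u]} \<union> {Const (ws @ [u])} \<turnstile>\<^bsub>\<tau>\<^esub> ?\<chi>"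
    by (rule derives.weakening) (use Cons.prems in auto)
  moreover have "?\<Sigma> \<union> {Const [u]} \<turnstile>\<^bsub>\<tau>\<^esub> Const (ws @ [u])"
    by (rule derives_Const_append)
      (use form Cons.prems in \<open>auto intro!: derives.assumption\<close>)
  ultimately have "?\<Sigma> \<union> {Const [u]} \<turnstile>\<^bsub>\<tau>\<^esub> ?\<chi>"
    using derives.cut by blast
  then have "?\<Sigma> \<union> {Const [u]} \<turnstile>\<^bsub>\<tau>\<^esub> Exists u ?\<chi>"
    using form by (rule derives_Exists)
  \<comment> \<open>The premise \<open>Const [u]\<close> may be put under a quantifier because
    \<open>u\<close> is not free in \<open>Const ws\<close>, \<open>\<phi>\<close> or the
    conclusion; its quantified form is derivable outright and is cut away next.\<close>
  then have "?\<Sigma> \<union> {Exists u (Const [u])} \<turnstile>\<^bsub>\<tau>\<^esub> Exists u ?\<chi>"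
    by (rule derives.exists_elim) (use Cons.prems in auto)
  moreover have "?\<Sigma> \<turnstile>\<^bsub>\<tau>\<^esub> Exists u (Const [u])"
    using form by (intro derives_Exists_Const) auto
  ultimately show ?case
    using derives.cut by fastforce
qed

theorem proposition3p17:
  fixes \<tau> :: "'r vocab" and zs :: "var list" and n :: nat
  assumes "is_vocab \<tau>"
    and "length zs \<ge> 1" and "distinct zs" and "\<forall>z\<in>set zs. sort z = n"
    and "n \<notin> sorts \<tau>"
  shows "(\<forall>(A :: ('r, 'a) struct) X. is_struct \<tau> A \<and> is_team \<tau> A X \<longrightarrow>
            sat (HExists (hd zs) (foldr Exists (tl zs) (Const zs))) A X) \<and>
         (\<forall>\<phi> :: 'r form. is_form \<phi> \<tau> \<and> set zs \<inter> vars \<phi> = {} \<and>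
            is_form (HExists (hd zs) (foldr Exists (tl zs) (Conj (Const zs) \<phi>))) \<tau> \<longrightarrow>
            {\<phi>} \<turnstile>\<^bsub>\<tau>\<^esub> HExists (hd zs) (foldr Exists (tl zs) (Conj (Const zs) \<phi>)))"
proof -
  obtain z us where zs: "zs = z # us"
    using assms(2) by (cases zs) auto
  have n: "sort z = n"
    using assms(4) zs by simp
  have "sat (HExists z (foldr Exists us (Const zs))) A X" for A :: "('r, 'a) struct" and X
  proof -
    \<comment> \<open>Any one-element domain would do; \<open>undefined\<close> merely names some
      element of the universe type.\<close>
    let ?B = "expand A (sort z) {undefined}"
    have "sat (foldr Exists zs (Const ([] @ zs))) ?B X"
      using assms(4) n by (intro sat_foldr_Exists_Const[of X "[]" undefined]) (auto simp: expand_def)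
    then have "sat (Exists z (foldr Exists us (Const zs))) ?B X"
      by (simp add: zs)
    then show ?thesis
      unfolding sat_HExists_iff by blast
  qed
  moreover have "{\<phi>} \<turnstile>\<^bsub>\<tau>\<^esub> HExists z (foldr Exists us (Conj (Const zs) \<phi>))"
    if form: "is_form \<phi> \<tau>" "is_form (HExists z (foldr Exists us (Conj (Const zs) \<phi>))) \<tau>"
    for \<phi> :: "'r form"
  proof (rule derives.hexists_intro1)
    let ?\<tau>' = "add_sort (sort z) \<tau>"
    \<comment> \<open>This comes from well-formedness of the target formula, whose body contains
      \<open>\<phi>\<close> as a conjunct; it does not follow from
      \<open>is_form \<phi> \<tau>\<close>, since \<open>\<phi>\<close> might bind the new sort by a
      tilde quantifier.\<close>
    have form': "is_form \<phi> ?\<tau>'"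
      using form(2) by simp
    have new: "n \<notin> sort ` vars \<phi>"
      using new_sort_notin_vars[OF form(1)] form' n assms by simp
    then show "\<forall>\<chi>\<in>{\<phi>}. is_form \<chi> \<tau> \<and> sort z \<notin> sort ` vars \<chi>"
      using form(1) n by simp
    have "fv \<phi> \<subseteq> vars \<phi>"
      by (induction \<phi>) auto
    then have "set zs \<inter> fv \<phi> = {}"
      using new assms(4) by auto
    then have "{Const [], \<phi>} \<turnstile>\<^bsub>?\<tau>'\<^esub> foldr Exists zs (Conj (Const ([] @ zs)) \<phi>)"
      using assms n form' by (intro derives_foldr_Exists_Const) auto
    then have "{\<phi>} \<union> {Const []} \<turnstile>\<^bsub>?\<tau>'\<^esub> Exists z (foldr Exists us (Conj (Const zs) \<phi>))"
      by (simp add: zs insert_commute)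
    \<comment> \<open>The accumulator starts empty, and constancy of the empty tuple is an instance
      of reflexivity.\<close>
    moreover have "{\<phi>} \<turnstile>\<^bsub>?\<tau>'\<^esub> Const []"
      using derives_Dep_reflexivity[of "{\<phi>}" ?\<tau>' "[]" "[]"] form' by simp
    ultimately show "{\<phi>} \<turnstile>\<^bsub>?\<tau>'\<^esub> Exists z (foldr Exists us (Conj (Const zs) \<phi>))"
      using derives.cut by blast
  qed fact
  ultimately show ?thesis
    by (simp add: zs)
qed

end
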